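(* Let $1<p,q<\infty$ and $n\geq 2$, and let $u,v$ be weights on $\mathbf{R}^n$ with $w=v^{-p'/p}$. Consider the following statements. (i) There is a constant $C$ such that $u(R^\circ)^{1/q}w(nR)^{1/p'}\leq C$ and $u(nR)^{1/q}w(R^\circ)^{1/p'}\leq C$ for all rectanguloids $R$ centered at the origin. (ii) There is a constant $C$ such that $u(S^\circ)^{1/q}w(\sqrt{n}\, S)^{1/p'}\leq C$ and $u(\sqrt{n}\, S)^{1/q}w(S^\circ)^{1/p'}\leq C$ for all ellipsoids $S$ centered at the origin. (iii) There is a constant $C$ such that $u(E^\circ)^{1/q}w(E)^{1/p'}\leq C$ and $u(E)^{1/q}w(E^\circ)^{1/p'}\leq C$ for all sets $E\subset\mathbf{R}^n$ that are bounded, measurable, contain the origin, and have non-empty interiors. Then (i) $\Rightarrow$ (ii) $\Rightarrow$ (iii). If, in addition, $u(\sqrt{n}A)\approx u(A)$ and $w(\sqrt{n}A)\approx w(A)$ for all rectanguloids and ellipsoids $A$, then the three statements are equivalent.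
   Context: A weight is a nonnegative, locally integrable function on $\mathbf{R}^n$. Here $p'=p/(p-1)$, and $w=v^{-p'/p}$ is assumed to be locally integrable. For a measurable set $E$, $u(E)=\int_E u$ and $w(E)=\int_E w$. For a bounded set $A\subset\mathbf{R}^n$ containing the origin, its polar is $A^\circ=\{z\in\mathbf{R}^n: |x\cdot z|\le 1\text{ for all }x\in A\}$. For $k\in\mathbf{R}$, $kA=\{kx:x\in A\}$. Rectanguloids (solid rectangular boxes) and ellipsoids (solid) have non-empty interior but need not have any particular orientation with respect to the coordinate axes. The notation $u(\sqrt n A)\approx u(A)$ for all $A$ in a class means that there are positive constants $c_1,c_2$, independent of $A$, with $c_1u(A)\le u(\sqrt nA)\le c_2u(A)$ for all such $A$; similarly for $w$. *)

theory Defs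
  imports "HOL-Analysis.Analysis"
begin

definition weight :: "('a::euclidean_space \<Rightarrow> real) \<Rightarrow> bool" where
  "weight u \<longleftrightarrow> (\<forall>x. 0 \<le> u x) \<and> (\<forall>K. compact K \<longrightarrow> set_integrable lebesgue K u)"

definition conj_exp :: "real \<Rightarrow> real" where
  "conj_exp p = p / (p - 1)"

text \<open>
  The function \<open>w = v^(-p'/p)\<close>. The exponent is negative, so its value is infinite where \<open>v\<close>
  vanishes, whereas \<open>0 powr a = 0\<close>. This is why it takes values in \<open>ennreal\<close>; its local
  integrability then forces \<open>v > 0\<close> almost everywhere.
\<close>

definition dual_weight :: "real \<Rightarrow> ('a \<Rightarrow> real) \<Rightarrow> 'a \<Rightarrow> ennreal" where
  "dual_weight p v x = (if v x = 0 then \<infinity> else ennreal (v x powr (- (conj_exp p / p))))"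

definition locally_integrable_ennreal :: "('a::euclidean_space \<Rightarrow> ennreal) \<Rightarrow> bool" where
  "locally_integrable_ennreal w \<longleftrightarrow>
     w \<in> borel_measurable lebesgue \<and>
     (\<forall>K. compact K \<longrightarrow> (\<integral>\<^sup>+x\<in>K. w x \<partial>lebesgue) < \<infinity>)"

text \<open>
  The integral of \<open>f\<close> over \<open>E\<close>, as a real number. It is only applied to locally integrable \<open>f\<close>
  and bounded measurable \<open>E\<close> (the polar of a set with non-empty interior is bounded), so that the
  convention that \<open>measure\<close> is 0 on sets of infinite mass plays no role.
\<close>

definition mass :: "('a::euclidean_space \<Rightarrow> ennreal) \<Rightarrow> 'a set \<Rightarrow> real" where
  "mass f E = measure (density lebesgue f) E"

definition polar :: "'a::real_inner set \<Rightarrow> 'a set" where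
  "polar A = {z. \<forall>x\<in>A. \<bar>x \<bullet> z\<bar> \<le> 1}"

definition dilate :: "real \<Rightarrow> 'a::real_vector set \<Rightarrow> 'a set" where
  "dilate k A = (\<lambda>x. k *\<^sub>R x) ` A"

definition rectanguloid_at :: "real ^ 'n \<Rightarrow> (real ^ 'n) set \<Rightarrow> bool" where
  "rectanguloid_at c R \<longleftrightarrow>
     (\<exists>(T :: real ^ 'n \<Rightarrow> real ^ 'n) (a :: real ^ 'n). orthogonal_transformation T \<and> (\<forall>i. 0 < a $ i) \<and>
        R = (\<lambda>x. c + T x) ` {x. \<forall>i. \<bar>x $ i\<bar> \<le> a $ i})"

definition ellipsoid_at :: "real ^ 'n \<Rightarrow> (real ^ 'n) set \<Rightarrow> bool" where
  "ellipsoid_at c S \<longleftrightarrow>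
     (\<exists>(T :: real ^ 'n \<Rightarrow> real ^ 'n) (a :: real ^ 'n). orthogonal_transformation T \<and> (\<forall>i. 0 < a $ i) \<and>
        S = (\<lambda>x. c + T x) ` {x. (\<Sum>i\<in>UNIV. (x $ i / a $ i)\<^sup>2) \<le> 1})"

definition rectanguloid_condition ::
  "real \<Rightarrow> real \<Rightarrow> (real ^ 'n \<Rightarrow> ennreal) \<Rightarrow> (real ^ 'n \<Rightarrow> ennreal) \<Rightarrow> bool" where
  "rectanguloid_condition p q u w \<longleftrightarrow>
     (\<exists>C. \<forall>R. rectanguloid_at 0 R \<longrightarrow>
        mass u (polar R) powr (1 / q) *
          mass w (dilate (real CARD('n)) R) powr (1 / conj_exp p) \<le> C \<and>
        mass u (dilate (real CARD('n)) R) powr (1 / q) *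
          mass w (polar R) powr (1 / conj_exp p) \<le> C)"

definition ellipsoid_condition ::
  "real \<Rightarrow> real \<Rightarrow> (real ^ 'n \<Rightarrow> ennreal) \<Rightarrow> (real ^ 'n \<Rightarrow> ennreal) \<Rightarrow> bool" where
  "ellipsoid_condition p q u w \<longleftrightarrow>
     (\<exists>C. \<forall>S. ellipsoid_at 0 S \<longrightarrow>
        mass u (polar S) powr (1 / q) *
          mass w (dilate (sqrt (real CARD('n))) S) powr (1 / conj_exp p) \<le> C \<and>
        mass u (dilate (sqrt (real CARD('n))) S) powr (1 / q) *
          mass w (polar S) powr (1 / conj_exp p) \<le> C)"

definition bounded_set_condition ::
  "real \<Rightarrow> real \<Rightarrow> (real ^ 'n \<Rightarrow> ennreal) \<Rightarrow> (real ^ 'n \<Rightarrow> ennreal) \<Rightarrow> bool" where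
  "bounded_set_condition p q u w \<longleftrightarrow>
     (\<exists>C. \<forall>E. bounded E \<and> E \<in> sets lebesgue \<and> 0 \<in> E \<and> interior E \<noteq> {} \<longrightarrow>
        mass u (polar E) powr (1 / q) * mass w E powr (1 / conj_exp p) \<le> C \<and>
        mass u E powr (1 / q) * mass w (polar E) powr (1 / conj_exp p) \<le> C)"

text \<open>\<open>f(\<surd>n A) \<approx> f(A)\<close> over all rectanguloids and ellipsoids \<open>A\<close>, with arbitrary centers.\<close>

definition dilation_comparable :: "(real ^ 'n \<Rightarrow> ennreal) \<Rightarrow> bool" where
  "dilation_comparable f \<longleftrightarrow>
     (\<exists>c1>0. \<exists>c2>0. \<forall>A c. rectanguloid_at c A \<or> ellipsoid_at c A \<longrightarrow>
        c1 * mass f A \<le> mass f (dilate (sqrt (real CARD('n))) A) \<and>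
        mass f (dilate (sqrt (real CARD('n))) A) \<le> c2 * mass f A)"

end

theory Submission
  imports Defs
begin

text \<open>
  An ellipsoid with semi-axes \<open>a\<close> contains the box \<open>R\<close> with half-sides \<open>a / \<surd>n\<close> and the same axes,
  and is contained in \<open>\<surd>n R\<close>; as polars reverse inclusions, (i) implies (ii).

  For (ii) \<open>\<Rightarrow>\<close> (iii) one needs, for each \<open>E\<close>, an ellipsoid \<open>S\<close> with \<open>E \<subseteq> \<surd>n S\<close> and
  \<open>E\<^sup>\<circ> \<subseteq> S\<^sup>\<circ>\<close>. It is \<open>L / \<surd>n\<close>, where \<open>L = {x. |A x| \<le> 1}\<close> is the centered ellipsoid of least
  volume containing \<open>E\<close>, that is, \<open>|det A|\<close> is maximal. If some \<open>z \<in> E\<^sup>\<circ>\<close> had width greater than \<open>\<surd>n\<close>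
  on \<open>L\<close>, then \<open>E\<close> would lie in a slab of \<open>L\<close> so thin that squeezing \<open>L\<close> towards the slab and
  widening it slightly in the other directions would keep \<open>E\<close> inside and decrease the volume.

  Under the dilation hypothesis, boxes and ellipsoids are themselves admissible in (iii), and the
  factors \<open>\<surd>n\<close> and \<open>n\<close> cost only constants.
\<close>


section \<open>Spectral theorem for self-adjoint maps, and ellipsoids as preimages of the unit
  ball\<close>

text \<open>The quadratic form \<open>x \<bullet> f x\<close> attains its maximum on the compact
  unit sphere of \<open>S\<close>. At a maximizer \<open>e\<close> the first variation in the
  direction of the residual \<open>r = f e - c *\<^sub>R e\<close> must vanish, and it is a multiple
  of \<open>r \<bullet> r\<close>.\<close>

lemma selfadjoint_eigenvector:
  fixes f :: "'a::euclidean_space \<Rightarrow> 'a"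
  assumes lin: "linear f" and sa: "\<And>x y. f x \<bullet> y = x \<bullet> f y"
    and S: "subspace S" "f ` S \<subseteq> S" "S \<noteq> {0}"
  obtains e c where "e \<in> S" "norm e = 1" "f e = c *\<^sub>R e"
proof -
  let ?K = "S \<inter> sphere 0 1"
  obtain a where a: "a \<in> S" "a \<noteq> 0"
    using S subspace_0 by blast
  then have "a /\<^sub>R norm a \<in> ?K"
    by (simp add: S(1) subspace_scale)
  then have "?K \<noteq> {}" by blast
  moreover have "compact ?K"
    using S(1) by (simp add: closed_Int_compact closed_subspace)
  moreover have "continuous_on ?K (\<lambda>x. x \<bullet> f x)"
    using lin by (intro continuous_intros linear_continuous_on)
      (simp add: linear_conv_bounded_linear)
  ultimately obtain e where e: "e \<in> ?K" and max: "\<And>x. x \<in> ?K \<Longrightarrow> x \<bullet> f x \<le> e \<bullet> f e"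
    by (metis continuous_attains_sup)
  define c where "c = e \<bullet> f e"
  have le: "x \<bullet> f x \<le> c * (x \<bullet> x)" if "x \<in> S" for x
  proof (cases "x = 0")
    case False
    then have "x /\<^sub>R norm x \<in> ?K"
      using that by (simp add: S(1) subspace_scale)
    then have "(x /\<^sub>R norm x) \<bullet> f (x /\<^sub>R norm x) \<le> c"
      unfolding c_def by (rule max)
    then show ?thesis
      using False by (simp add: linear_scale[OF lin] dot_square_norm field_simps power2_eq_square)
  qed (simp add: linear_0[OF lin])
  define r where "r = f e - c *\<^sub>R e"
  have ee: "e \<bullet> e = 1" "e \<in> S"
    using e by (auto simp: dot_square_norm)
  then have rS: "r \<in> S"
    using S by (auto simp: r_def intro!: subspace_diff subspace_scale)
  have re: "r \<bullet> e = 0"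
    using ee by (simp add: r_def c_def inner_diff_left inner_diff_right inner_commute)
  then have fer: "f e \<bullet> r = r \<bullet> r"
    using ee by (simp add: r_def inner_diff_left inner_diff_right inner_commute)
  \<comment> \<open>This is \<open>le\<close> at the perturbed point
    \<open>e + t *\<^sub>R r\<close>; the constant terms cancel because \<open>r\<close> is
    orthogonal to \<open>e\<close>, and self-adjointness merges the two mixed terms.\<close>
  have ineq: "2 * (r \<bullet> r) * t + t\<^sup>2 * (r \<bullet> f r) \<le> t\<^sup>2 * c * (r \<bullet> r)" for t
  proof -
    have "e + t *\<^sub>R r \<in> S"
      using S ee rS by (simp add: subspace_add subspace_scale)
    from le[OF this] show ?thesis
      using ee re fer sa[of e r] by (simp add: linear_add[OF lin] linear_scale[OF lin] inner_add_left inner_add_right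
          inner_commute[of r e] inner_commute[of r "f e"] c_def algebra_simps power2_eq_square)
  qed
  have "r \<bullet> r = 0"
  proof (rule ccontr)
    assume ne: "r \<bullet> r \<noteq> 0"
    \<comment> \<open>A positive bound for the quadratic coefficient. With
      \<open>t = (r \<bullet> r) / k\<close> the quadratic term is too small to absorb the linear
      one: \<open>2 * (r \<bullet> r) \<le> t * k = r \<bullet> r\<close>.\<close>
    define k where "k = \<bar>c * (r \<bullet> r) - r \<bullet> f r\<bar> + 1"
    define t where "t = (r \<bullet> r) / k"
    have k: "k > 0" by (simp add: k_def)
    have pos: "r \<bullet> r > 0" using ne by (simp add: less_le)
    then have t: "t > 0" using k by (simp add: t_def)
    have "t * (2 * (r \<bullet> r)) \<le> t * (t * (c * (r \<bullet> r) - r \<bullet> f r))"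
      using ineq[of t] by (simp add: algebra_simps power2_eq_square)
    then have "2 * (r \<bullet> r) \<le> t * (c * (r \<bullet> r) - r \<bullet> f r)"
      using t by (simp only: mult_le_cancel_left_pos)
    also have "\<dots> \<le> t * k"
      using t by (intro mult_left_mono) (auto simp: k_def)
    also have "\<dots> = r \<bullet> r" using k by (simp add: t_def)
    finally show False using pos by simp
  qed
  then have "f e = c *\<^sub>R e" by (simp add: r_def)
  with e that show ?thesis by auto
qed

text \<open>Induction on the dimension: after splitting off a unit eigenvector \<open>e\<close>, its
  orthogonal complement in \<open>S\<close> is again invariant, since
  \<open>e \<bullet> f x = f e \<bullet> x\<close>.\<close>

lemma selfadjoint_orthonormal_eigenbasis:
  fixes f :: "'a::euclidean_space \<Rightarrow> 'a"
  assumes lin: "linear f" and sa: "\<And>x y. f x \<bullet> y = x \<bullet> f y"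
  shows "subspace S \<Longrightarrow> f ` S \<subseteq> S \<Longrightarrow>
    \<exists>B. pairwise orthogonal B \<and> (\<forall>b\<in>B. norm b = 1 \<and> (\<exists>c. f b = c *\<^sub>R b)) \<and> span B = S"
proof (induction "dim S" arbitrary: S rule: less_induct)
  case less
  show ?case
  proof (cases "S = {0}")
    case True
    then show ?thesis by (intro exI[of _ "{}"]) auto
  next
    case False
    obtain e c where e: "e \<in> S" "norm e = 1" "f e = c *\<^sub>R e"
      using selfadjoint_eigenvector[OF lin sa less.prems False] by metis
    have ee: "e \<bullet> e = 1" using e by (simp add: dot_square_norm)
    define S' where "S' = {x \<in> S. e \<bullet> x = 0}"
    have sub: "subspace S'"
      using less.prems(1) by (auto simp: S'_def subspace_def inner_add_right)
    have inv: "f ` S' \<subseteq> S'"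
    proof clarify
      fix x assume x: "x \<in> S'"
      have "e \<bullet> f x = f e \<bullet> x" by (simp add: sa)
      then show "f x \<in> S'" using x e less.prems(2) by (auto simp: S'_def)
    qed
    have "e \<in> S - S'" "S' \<subseteq> S" using e ee by (auto simp: S'_def)
    then have "S' \<subset> S" by blast
    then have "dim S' < dim S"
      by (intro dim_psubset) (metis sub less.prems(1) span_eq_iff)
    then obtain B where B: "pairwise orthogonal B" "\<And>b. b \<in> B \<Longrightarrow> norm b = 1 \<and> (\<exists>c. f b = c *\<^sub>R b)"
      "span B = S'" using less.hyps[OF _ sub inv] by blast
    have BS: "B \<subseteq> S'" using B(3) span_superset by blast
    show ?thesis
    proof (intro exI[of _ "insert e B"] conjI ballI)
      show "pairwise orthogonal (insert e B)"
        using B(1) BS by (auto simp: pairwise_insert S'_def orthogonal_def inner_commute)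
      show "norm b = 1" "\<exists>c. f b = c *\<^sub>R b" if "b \<in> insert e B" for b
        using that B(2) e by auto
      show "span (insert e B) = S"
      proof
        show "span (insert e B) \<subseteq> S"
          using BS e(1) less.prems(1) by (intro span_minimal) (auto simp: S'_def)
        show "S \<subseteq> span (insert e B)"
        proof
          fix x assume x: "x \<in> S"
          have "x - (e \<bullet> x) *\<^sub>R e \<in> span B"
            unfolding B(3) S'_def using x e(1) ee less.prems(1)
            by (auto simp: inner_diff_right intro!: subspace_diff subspace_scale)
          then show "x \<in> span (insert e B)"
            by (auto simp: span_insert)
        qed
      qed
    qed
  qed
qed

lemma inner_sum_orthogonal:
  fixes g :: "'i::finite \<Rightarrow> 'a::real_inner"
  assumes "\<And>i j. i \<noteq> j \<Longrightarrow> g i \<bullet> g j = 0"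
  shows "(\<Sum>i\<in>UNIV. a i *\<^sub>R g i) \<bullet> (\<Sum>i\<in>UNIV. b i *\<^sub>R g i) = (\<Sum>i\<in>UNIV. a i * b i * (g i \<bullet> g i))"
proof -
  have "(\<Sum>j\<in>UNIV. (a i *\<^sub>R g i) \<bullet> (b j *\<^sub>R g j)) = a i * b i * (g i \<bullet> g i)" for i
  proof -
    have "(\<Sum>j\<in>UNIV. (a i *\<^sub>R g i) \<bullet> (b j *\<^sub>R g j)) = (\<Sum>j\<in>UNIV. if j = i then a i * b i * (g i \<bullet> g i) else 0)"
      using assms by (intro sum.cong) auto
    then show ?thesis by simp
  qed
  then show ?thesis
    unfolding inner_sum_left unfolding inner_sum_right by simp
qed

text \<open>An orthonormal eigenbasis \<open>h\<close> of \<open>transpose A ** A\<close> is mapped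
  by \<open>A\<close> to an orthogonal system. In the coordinates of \<open>h\<close> the norm of
  \<open>A *v x\<close> is therefore a weighted sum of squares, with semi-axes
  \<open>1 / norm (A *v h i)\<close>.\<close>

lemma ellipsoid_at_vimage_cball:
  fixes A :: "real ^ 'n ^ 'n"
  assumes A: "invertible A"
  shows "ellipsoid_at 0 {x. norm (A *v x) \<le> 1}"
proof -
  define f where "f = (\<lambda>x. transpose A *v (A *v x))"
  have f: "f x \<bullet> y = (A *v x) \<bullet> (A *v y)" for x y
    by (simp add: f_def transpose_matrix_vector dot_lmul_matrix)
  have lin: "linear f"
    using linear_compose[OF matrix_vector_mul_linear[of A] matrix_vector_mul_linear[of "transpose A"]]
    by (simp add: f_def o_def del: transpose_matrix_vector)
  obtain B where B: "pairwise orthogonal B" "\<And>b. b \<in> B \<Longrightarrow> norm b = 1"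
    "\<And>b. b \<in> B \<Longrightarrow> \<exists>c. f b = c *\<^sub>R b" "span B = UNIV"
    using selfadjoint_orthonormal_eigenbasis[of f UNIV, OF lin]
    by (metis f inner_commute subspace_UNIV subset_UNIV)
  have "0 \<notin> B" using B(2) by force
  then have ind: "independent B"
    by (intro pairwise_orthogonal_independent B)
  have "card B = dim (UNIV :: (real^'n) set)"
    using ind B(4) by (metis dim_eq_card_independent dim_span)
  then have "card B = CARD('n)" by simp
  then obtain h :: "'n \<Rightarrow> real^'n" where h: "bij_betw h UNIV B"
    by (metis finite_class.finite_UNIV finite_same_card_bij ind independent_imp_finite)
  then have hB: "h i \<in> B" for i by (auto simp: bij_betw_def)
  have hh: "h i \<bullet> h j = 0" if "i \<noteq> j" for i j
    using that B(1) hB h unfolding pairwise_def orthogonal_def bij_betw_def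
    by (metis UNIV_I inj_onD)
  have hn: "h i \<bullet> h i = 1" for i using B(2)[OF hB] by (simp add: dot_square_norm)
  have Ahh: "(A *v h i) \<bullet> (A *v h j) = 0" if "i \<noteq> j" for i j
    using B(3)[OF hB, of i] hh[OF that] by (auto simp: f[symmetric])
  define T where "T = (\<lambda>y::real^'n. \<Sum>i\<in>UNIV. y $ i *\<^sub>R h i)"
  have linT: "linear T"
    by (auto simp: T_def linear_iff scaleR_left_distrib sum.distrib scaleR_sum_right)
  have "T v \<bullet> T w = (\<Sum>i\<in>UNIV. v $ i * w $ i)" for v w
    by (simp add: T_def inner_sum_orthogonal[OF hh] hn)
  then have T: "orthogonal_transformation T"
    using linT by (simp add: orthogonal_transformation_def inner_vec_def)
  define a where "a = (\<chi> i. 1 / norm (A *v h i))"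
  have Ah: "A *v h i \<noteq> 0" for i
    using A hn[of i] by (auto simp: invertible_left_inverse matrix_left_invertible_ker)
  have "(norm (A *v T y))\<^sup>2 = (\<Sum>i\<in>UNIV. (y $ i / a $ i)\<^sup>2)" for y
  proof -
    have "A *v T y = (\<Sum>i\<in>UNIV. y $ i *\<^sub>R (A *v h i))"
      by (simp add: T_def linear_sum[OF matrix_vector_mul_linear] matrix_vector_mult_scaleR)
    then have "(norm (A *v T y))\<^sup>2 = (\<Sum>i\<in>UNIV. y $ i * y $ i * ((A *v h i) \<bullet> (A *v h i)))"
      by (simp add: power2_norm_eq_inner inner_sum_orthogonal[OF Ahh])
    then show ?thesis
      by (simp add: a_def power2_eq_square dot_square_norm mult_ac)
  qed
  moreover have "norm x \<le> 1 \<longleftrightarrow> (norm x)\<^sup>2 \<le> 1" for x :: "real^'n"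
    by (simp add: power_le_one_iff)
  ultimately have eq: "norm (A *v T y) \<le> 1 \<longleftrightarrow> (\<Sum>i\<in>UNIV. (y $ i / a $ i)\<^sup>2) \<le> 1" for y
    by simp
  have "{x. norm (A *v x) \<le> 1} = T ` {y. (\<Sum>i\<in>UNIV. (y $ i / a $ i)\<^sup>2) \<le> 1}"
    using orthogonal_transformation_surj[OF T] eq by (auto simp: surj_def image_iff) metis
  then show ?thesis
    using T Ah unfolding ellipsoid_at_def by (intro exI[of _ T] exI[of _ a]) (auto simp: a_def)
qed

section \<open>The centered ellipsoid of least volume\<close>

text \<open>
  The squared determinant of the diagonal stretch with squared factor \<open>1 + e (s - 1)\<close> in one direction
  and \<open>1 - e\<close> in the others. Its derivative in \<open>e\<close> at 0 is \<open>s - n\<close>.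
\<close>

lemma stretch_factor_gt_one:
  fixes s :: real
  assumes n: "n \<ge> 1" and s: "s > real n"
  obtains e where "0 < e" "e < 1" "(1 + e * (s - 1)) * (1 - e) ^ (n - 1) > 1"
proof -
  \<comment> \<open>Chosen so that \<open>e * (s * n) = (s - n) / 2\<close>: the second-order loss,
    bounded by this quantity, takes at most half of the first-order gain
    \<open>s - n\<close>.\<close>
  define e where "e = (s - n) / (2 * s * n)"
  have s1: "s > 1" "real n \<ge> 1" using assms by auto
  have e0: "e > 0" using assms by (simp add: e_def)
  have "s * 1 \<le> s * n"
    using s1 by (intro mult_left_mono) auto
  then have "s - n < 2 * s * n"
    unfolding mult.assoc using s1 by linarith
  then have e1: "e < 1" using s1 by (simp add: e_def)
  have bern: "1 - (real n - 1) * e \<le> (1 - e) ^ (n - 1)"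
    using Bernoulli_inequality[of "-e" "n - 1"] e1 n by (simp add: of_nat_diff)
  have "(s - 1) * (real n - 1) \<le> s * n"
    using s1 by (intro mult_mono) auto
  then have "e * ((s - 1) * (real n - 1)) \<le> e * (s * n)"
    using e0 by (intro mult_left_mono) auto
  also have "\<dots> = (s - n) / 2" using s1 by (simp add: e_def)
  finally have "0 < (s - n) - e * ((s - 1) * (real n - 1))" using s by simp
  then have "0 < e * ((s - n) - e * ((s - 1) * (real n - 1)))" using e0 by simp
  also have "\<dots> = (1 + e * (s - 1)) * (1 - (real n - 1) * e) - 1"
    by (simp add: algebra_simps)
  finally have "1 < (1 + e * (s - 1)) * (1 - (real n - 1) * e)" by simp
  also have "\<dots> \<le> (1 + e * (s - 1)) * (1 - e) ^ (n - 1)"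
    using e0 s1 by (intro mult_left_mono bern) auto
  finally show ?thesis using e0 e1 that by blast
qed

text \<open>In the coordinates \<open>A *v x\<close> the set \<open>E\<close> lies in the unit ball
  and in the slab given by \<open>y\<close>, of half-width \<open>1 / norm y\<close>. The new matrix
  rotates \<open>y\<close> to a coordinate axis by \<open>Q\<close> and then applies a diagonal
  stretch \<open>D\<close>, whose determinant exceeds 1 by
  \<open>stretch_factor_gt_one\<close>.\<close>

lemma exists_larger_det:
  fixes A :: "real ^ 'n ^ 'n"
  assumes A: "invertible A" and E: "\<And>x. x \<in> E \<Longrightarrow> norm (A *v x) \<le> 1"
    and y: "\<And>x. x \<in> E \<Longrightarrow> \<bar>(A *v x) \<bullet> y\<bar> \<le> 1" and s: "(norm y)\<^sup>2 > real CARD('n)"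
  obtains A' where "\<And>x. x \<in> E \<Longrightarrow> norm (A' *v x) \<le> 1" "\<bar>det A'\<bar> > \<bar>det A\<bar>"
proof -
  let ?n = "CARD('n)"
  define s where "s = (norm y)\<^sup>2"
  have s1: "s > 1" using s by (simp add: s_def) (smt (verit) of_nat_1 of_nat_le_iff zero_less_card_finite Suc_leI One_nat_def)
  obtain e where e: "0 < e" "e < 1" "(1 + e * (s - 1)) * (1 - e) ^ (?n - 1) > 1"
    using stretch_factor_gt_one[of ?n s] s by (auto simp: s_def Suc_le_eq)
  \<comment> \<open>An arbitrary coordinate, onto whose axis \<open>y\<close> is rotated.\<close>
  define k :: 'n where "k = undefined"
  have "norm y = norm (norm y *\<^sub>R axis k (1::real))" by simp
  then obtain Q where Q: "orthogonal_transformation Q" "Q y = norm y *\<^sub>R axis k (1::real)"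
    using orthogonal_transformation_exists by blast
  define d where "d = (\<lambda>i::'n. sqrt (if i = k then 1 + e * (s - 1) else 1 - e))"
  define D where "D = (\<chi> i j. if i = j then d i else 0)"
  define A' where "A' = D ** matrix Q ** A"
  have d2: "(d i)\<^sup>2 = (if i = k then 1 + e * (s - 1) else 1 - e)" for i
    using e s1 by (auto simp: d_def)
  have Dv: "(D *v v) $ i = d i * v $ i" for v i
    by (simp add: D_def matrix_vector_mult_def if_distrib[of "\<lambda>x. x * _"] cong: if_cong)
  have norm2: "(norm v)\<^sup>2 = (\<Sum>i\<in>UNIV. (v $ i)\<^sup>2)" for v :: "real ^ 'n"
    by (simp add: norm_vec_def L2_set_def sum_nonneg)
  have normD: "(norm (D *v v))\<^sup>2 = (1 - e) * (norm v)\<^sup>2 + e * s * (v $ k)\<^sup>2" for v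
  proof -
    have "(norm (D *v v))\<^sup>2 = (\<Sum>i\<in>UNIV. (d i)\<^sup>2 * (v $ i)\<^sup>2)"
      by (simp add: norm2 Dv power_mult_distrib)
    also have "\<dots> = (\<Sum>i\<in>UNIV. (1 - e) * (v $ i)\<^sup>2 + (if i = k then e * s * (v $ k)\<^sup>2 else 0))"
      by (intro sum.cong) (auto simp: d2 algebra_simps)
    also have "\<dots> = (1 - e) * (norm v)\<^sup>2 + e * s * (v $ k)\<^sup>2"
      by (simp add: sum.distrib sum_distrib_left[symmetric] norm2)
    finally show ?thesis .
  qed
  have mQ: "matrix Q *v v = Q v" for v
    using Q(1) by (simp add: matrix_works orthogonal_transformation_linear)
  have A'v: "A' *v x = D *v Q (A *v x)" for x
    by (simp add: A'_def matrix_vector_mul_assoc[symmetric] mQ)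
  show ?thesis
  proof
    fix x assume x: "x \<in> E"
    have "s * (Q (A *v x) $ k)\<^sup>2 = (Q (A *v x) \<bullet> Q y)\<^sup>2"
      by (simp add: Q(2) s_def inner_axis power_mult_distrib)
    also have "\<dots> = ((A *v x) \<bullet> y)\<^sup>2"
      using Q(1) by (simp add: orthogonal_transformation_def)
    also have "\<dots> \<le> 1" using y[OF x] by (simp add: abs_square_le_1)
    finally have 1: "s * (Q (A *v x) $ k)\<^sup>2 \<le> 1" .
    \<comment> \<open>A convex combination of two numbers that are at most 1, one by the ball
      constraint and one by the slab constraint.\<close>
    have "(norm (A' *v x))\<^sup>2 = (1 - e) * (norm (A *v x))\<^sup>2 + e * (s * (Q (A *v x) $ k)\<^sup>2)"
      using Q(1) by (simp add: A'v normD orthogonal_transformation_norm)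
    also have "\<dots> \<le> (1 - e) * 1 + e * 1"
      using e E[OF x] 1 by (intro add_mono mult_left_mono) (auto simp: power_le_one)
    finally show "norm (A' *v x) \<le> 1" by (simp add: power_le_one_iff)
  next
    have "det D = (\<Prod>i\<in>UNIV. d i)"
      by (subst det_diagonal) (auto simp: D_def)
    then have "(det D)\<^sup>2 = (\<Prod>i\<in>UNIV. (d i)\<^sup>2)"
      by (simp add: prod_power_distrib)
    also have "\<dots> = (d k)\<^sup>2 * (\<Prod>i\<in>UNIV - {k}. (d i)\<^sup>2)"
      by (rule prod.remove) auto
    also have "(\<Prod>i\<in>UNIV - {k}. (d i)\<^sup>2) = (\<Prod>i\<in>UNIV - {k}. 1 - e)"
      by (intro prod.cong) (auto simp: d2)
    also have "(d k)\<^sup>2 * (\<Prod>i\<in>UNIV - {k}. 1 - e) = (1 + e * (s - 1)) * (1 - e) ^ (?n - 1)"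
      by (simp add: d2)
    finally have "(det D)\<^sup>2 > 1" using e by simp
    then have "\<bar>det D\<bar> > 1" by (metis abs_square_le_1 not_le)
    moreover have "\<bar>det A'\<bar> = \<bar>det D\<bar> * \<bar>det A\<bar>"
      using Q(1) by (simp add: A'_def det_mul abs_mult)
    moreover have "\<bar>det A\<bar> > 0" using A by (simp add: invertible_det_nz)
    ultimately show "\<bar>det A'\<bar> > \<bar>det A\<bar>" by simp
  qed
qed

text \<open>Boundedness comes from a ball of radius \<open>r\<close> inside \<open>E\<close>,
  possibly away from the origin: comparing \<open>A\<close> at its center and at the center shifted
  by \<open>r\<close> along an axis bounds each column by \<open>2 / r\<close>.\<close>

lemma compact_contractions_on:
  fixes E :: "(real ^ 'n) set"
  assumes "interior E \<noteq> {}"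
  shows "compact {A :: real ^ 'n ^ 'm. \<forall>x\<in>E. norm (A *v x) \<le> 1}" (is "compact ?M")
proof -
  have "?M = (\<Inter>x\<in>E. {A. norm (A *v x) \<le> 1})" by auto
  moreover have "closed {A :: real ^ 'n ^ 'm. norm (A *v x) \<le> 1}" for x
    by (intro closed_Collect_le continuous_intros)
      (auto simp: matrix_vector_mult_def intro!: continuous_intros)
  ultimately have "closed ?M" by auto
  moreover have "bounded ?M"
  proof -
    obtain x0 r where r: "r > 0" "cball x0 r \<subseteq> E"
      using assms by (metis all_not_in_conv mem_interior_cball)
    have "norm A \<le> (\<Sum>i::'m\<in>UNIV. \<Sum>j::'n\<in>UNIV. 2 / r)" if A: "A \<in> ?M" for A :: "real ^ 'n ^ 'm"
    proof -
      have "\<bar>A $ i $ j\<bar> \<le> 2 / r" for i j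
      proof -
        have "norm (A *v (x0 + r *\<^sub>R axis j 1)) \<le> 1" "norm (A *v x0) \<le> 1"
          using A r by (auto simp: subset_iff dist_norm)
        then have "norm (A *v (x0 + r *\<^sub>R axis j 1) - A *v x0) \<le> 2"
          using norm_triangle_ineq4[of "A *v (x0 + r *\<^sub>R axis j 1)" "A *v x0"] by linarith
        then have "norm (r *\<^sub>R (A *v axis j 1)) \<le> 2"
          by (simp add: matrix_vector_right_distrib matrix_vector_mult_scaleR)
        then have "norm (column j A) \<le> 2 / r"
          using r by (simp add: matrix_vector_mult_basis field_simps)
        then show ?thesis
          using component_le_norm_cart[of "column j A" i] by (simp add: column_def)
      qed
      then have "norm (A $ i) \<le> (\<Sum>j::'n\<in>UNIV. 2 / r)" for i
        by (intro order.trans[OF norm_le_l1_cart] sum_mono)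
      then show ?thesis
        unfolding norm_vec_def[of A] by (intro order.trans[OF L2_set_le_sum] sum_mono) auto
    qed
    then show ?thesis by (auto simp: bounded_iff)
  qed
  ultimately show ?thesis by (simp add: compact_eq_bounded_closed)
qed

proposition Loewner_ellipsoid:
  fixes E :: "(real ^ 'n) set"
  assumes E: "bounded E" "interior E \<noteq> {}"
  obtains S where "ellipsoid_at 0 S" "E \<subseteq> dilate (sqrt (real CARD('n))) S" "polar E \<subseteq> polar S"
proof -
  let ?n = "real CARD('n)"
  define M where "M = {A :: real ^ 'n ^ 'n. \<forall>x\<in>E. norm (A *v x) \<le> 1}"
  obtain r where r: "r > 0" "\<And>x. x \<in> E \<Longrightarrow> norm x \<le> r"
    using E(1) by (auto simp: bounded_pos)
  \<comment> \<open>A competitor with nonzero determinant, which makes the maximizer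
    invertible.\<close>
  have I: "mat (1 / r) \<in> M" "det (mat (1 / r) :: real^'n^'n) > 0"
  proof -
    have "mat (1 / r) *v x = (1 / r) *\<^sub>R x" for x :: "real^'n"
      by (simp add: vec_eq_iff matrix_vector_mult_def mat_def if_distrib[of "\<lambda>x. x * _"] cong: if_cong)
    then show "mat (1 / r) \<in> M" using r by (auto simp: M_def field_simps)
    show "det (mat (1 / r) :: real^'n^'n) > 0"
      using r by (subst det_diagonal) (auto simp: mat_def)
  qed
  have "continuous_on M (\<lambda>A. \<bar>det A\<bar>)"
    unfolding det_def by (intro continuous_intros)
  then obtain A where A: "A \<in> M" and max: "\<And>A'. A' \<in> M \<Longrightarrow> \<bar>det A'\<bar> \<le> \<bar>det A\<bar>"
    using compact_contractions_on[OF E(2), where 'm = 'n] I(1) unfolding M_def[symmetric]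
    by (metis continuous_attains_sup empty_iff)
  have inv: "invertible A" using max[OF I(1)] I(2) by (auto simp: invertible_det_nz)
  then obtain A1 where A1: "A1 ** A = mat 1" by (auto simp: invertible_def)
  have width: "\<bar>x \<bullet> z\<bar> \<le> sqrt ?n" if z: "z \<in> polar E" and x: "norm (A *v x) \<le> 1" for x z
  proof -
    \<comment> \<open>With \<open>A1\<close> the inverse of \<open>A\<close>, this \<open>y\<close>
      represents the functional of \<open>z\<close> in the coordinates \<open>A *v x\<close>. Hence
      membership of \<open>z\<close> in the polar of \<open>E\<close> becomes the slab constraint of
      \<open>exists_larger_det\<close>.\<close>
    define y where "y = transpose A1 *v z"
    have xz: "(A *v x) \<bullet> y = x \<bullet> z" for x
    proof -
      have "(A *v x) \<bullet> y = (z v* A1) \<bullet> (A *v x)"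
        by (simp add: y_def inner_commute)
      also have "\<dots> = z \<bullet> (A1 *v (A *v x))"
        by (rule dot_lmul_matrix)
      finally have "(A *v x) \<bullet> y = z \<bullet> (A1 *v (A *v x))" .
      then show ?thesis by (simp add: matrix_vector_mul_assoc A1 inner_commute)
    qed
    have "(norm y)\<^sup>2 \<le> ?n"
    proof (rule ccontr)
      assume "\<not> (norm y)\<^sup>2 \<le> ?n"
      then obtain A' where "\<And>x. x \<in> E \<Longrightarrow> norm (A' *v x) \<le> 1" "\<bar>det A'\<bar> > \<bar>det A\<bar>"
        using exists_larger_det[OF inv, of E y] A z by (force simp: M_def xz polar_def)
      then show False using max[of A'] by (auto simp: M_def)
    qed
    then have "norm y \<le> sqrt ?n" by (rule real_le_rsqrt)
    then show ?thesis
      using Cauchy_Schwarz_ineq2[of "A *v x" y] mult_mono[OF x, of "norm y" "sqrt ?n"] by (simp add: xz)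
  qed
  \<comment> \<open>Multiplying the matrix by the root of the dimension shrinks the minimal
    ellipsoid by that factor, so the bound in \<open>width\<close> becomes the bound 1 that defines
    the polar.\<close>
  let ?A = "sqrt ?n *\<^sub>R A"
  let ?S = "{x. norm (?A *v x) \<le> 1}"
  have n: "sqrt ?n > 0" by simp
  have mult: "?A *v x = A *v (sqrt ?n *\<^sub>R x)" for x
    by (simp add: scaleR_matrix_vector_assoc matrix_vector_mult_scaleR)
  have "?A ** (A1 /\<^sub>R sqrt ?n) = mat 1 \<and> (A1 /\<^sub>R sqrt ?n) ** ?A = mat 1"
    using A1 matrix_left_right_inverse[of A1 A]
    by (auto simp: scalar_matrix_assoc matrix_scalar_ac)
  then have "ellipsoid_at 0 ?S"
    by (intro ellipsoid_at_vimage_cball) (auto simp: invertible_def)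
  moreover have "E \<subseteq> dilate (sqrt ?n) ?S"
  proof
    fix x assume "x \<in> E"
    then have "x /\<^sub>R sqrt ?n \<in> ?S" using A by (simp add: mult M_def)
    then show "x \<in> dilate (sqrt ?n) ?S"
      unfolding dilate_def by (rule rev_image_eqI) simp
  qed
  moreover have "polar E \<subseteq> polar ?S"
  proof
    fix z assume z: "z \<in> polar E"
    have "\<bar>x \<bullet> z\<bar> \<le> 1" if "x \<in> ?S" for x
    proof -
      have "\<bar>(sqrt ?n *\<^sub>R x) \<bullet> z\<bar> \<le> sqrt ?n"
        using that by (intro width z) (simp add: mult)
      then have "sqrt ?n * \<bar>x \<bullet> z\<bar> \<le> sqrt ?n * 1" by (simp add: abs_mult)
      then show ?thesis using n by (simp only: mult_le_cancel_left_pos)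
    qed
    then show "z \<in> polar ?S" by (auto simp: polar_def)
  qed
  ultimately show ?thesis by (rule that)
qed


section \<open>Weights and their masses\<close>

text \<open>Global measurability has to be recovered from integrability on compact sets:
  \<open>u\<close> is the pointwise limit of its restrictions to growing balls.\<close>

lemma locally_integrable_weight:
  assumes "weight u"
  shows "locally_integrable_ennreal (\<lambda>x. ennreal (u x))"
proof -
  have nn: "0 \<le> u x" and int: "compact K \<Longrightarrow> set_integrable lebesgue K u" for x K
    using assms by (auto simp: weight_def)
  have "u \<in> borel_measurable lebesgue"
  proof (rule borel_measurable_LIMSEQ_real)
    show "(\<lambda>x. indicator (cball 0 (real m)) x *\<^sub>R u x) \<in> borel_measurable lebesgue" for m
      using int[of "cball 0 (real m)"] unfolding set_integrable_def
      by (metis borel_measurable_integrable compact_cball)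
    fix x :: 'a
    have "\<forall>\<^sub>F m in sequentially. indicator (cball 0 (real m)) x *\<^sub>R u x = u x"
      using eventually_ge_at_top[of "nat \<lceil>norm x\<rceil>"]
      by eventually_elim (auto simp: indicator_def nat_ceiling_le_eq)
    then show "(\<lambda>m. indicator (cball 0 (real m)) x *\<^sub>R u x) \<longlonglongrightarrow> u x"
      by (rule tendsto_eventually)
  qed
  moreover have "(\<integral>\<^sup>+x\<in>K. ennreal (u x) \<partial>lebesgue) < \<infinity>" if "compact K" for K
  proof -
    have "(\<integral>\<^sup>+x\<in>K. ennreal (u x) \<partial>lebesgue) = (\<integral>\<^sup>+x. ennreal (indicator K x *\<^sub>R u x) \<partial>lebesgue)"
      by (intro nn_integral_cong) (auto simp: indicator_def)
    also have "\<dots> < \<infinity>"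
      using int[OF that] nn
      by (auto simp: set_integrable_def integrable_iff_bounded indicator_def abs_mult)
    finally show ?thesis .
  qed
  ultimately show ?thesis by (auto simp: locally_integrable_ennreal_def)
qed

lemma mass_nonneg: "0 \<le> mass f E"
  by (simp add: mass_def)

text \<open>Boundedness of \<open>B\<close> and local integrability make the larger mass finite.
  This matters because the conversion to a real number sends infinite mass to 0, which would break
  monotonicity.\<close>

lemma mass_mono:
  assumes f: "locally_integrable_ennreal f" and A: "A \<in> sets lebesgue" "A \<subseteq> B"
    and B: "B \<in> sets lebesgue" "bounded B"
  shows "mass f A \<le> mass f B"
proof -
  have m: "f \<in> borel_measurable lebesgue"
    using f by (simp add: locally_integrable_ennreal_def)
  have "emeasure (density lebesgue f) B \<le> (\<integral>\<^sup>+x\<in>closure B. f x \<partial>lebesgue)"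
    using m B closure_subset[of B]
    by (auto simp: emeasure_density indicator_def intro!: nn_integral_mono)
  also have "\<dots> < \<infinity>"
    using f B(2) by (simp add: locally_integrable_ennreal_def)
  finally show ?thesis
    unfolding mass_def measure_def using A B
    by (intro enn2real_mono emeasure_mono) auto
qed

lemma powr_mult_powr_mono:
  fixes a b :: real
  assumes "0 \<le> a" "a \<le> a'" "0 \<le> b" "b \<le> b'" "0 \<le> s" "0 \<le> t"
  shows "a powr s * b powr t \<le> a' powr s * b' powr t"
  using assms by (intro mult_mono powr_mono2) auto

text \<open>Absorbs a comparison of masses, such as that between a set and its dilate, into the
  constant of a product bound.\<close>

lemma powr_mult_powr_le:
  fixes a b :: real
  assumes "a powr s * b powr t \<le> C" "0 \<le> b" "0 \<le> b'" "b' \<le> c * b" "0 \<le> c" "0 \<le> t"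
  shows "a powr s * b' powr t \<le> C * c powr t"
proof -
  have "a powr s * b' powr t \<le> a powr s * (c * b) powr t"
    using assms by (intro mult_left_mono powr_mono2) auto
  also have "\<dots> = (a powr s * b powr t) * c powr t"
    using assms by (simp add: powr_mult)
  also have "\<dots> \<le> C * c powr t"
    using assms by (intro mult_right_mono) auto
  finally show ?thesis .
qed

section \<open>Polars, and centered boxes and ellipsoids\<close>

lemma polar_antimono: "A \<subseteq> B \<Longrightarrow> polar B \<subseteq> polar A"
  by (auto simp: polar_def)

lemma closed_polar: "closed (polar A)"
proof -
  have "polar A = (\<Inter>x\<in>A. {z. \<bar>x \<bullet> z\<bar> \<le> 1})" by (auto simp: polar_def)
  moreover have "closed {z. \<bar>x \<bullet> z\<bar> \<le> 1}" for x :: 'a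
    by (intro closed_Collect_le continuous_intros)
  ultimately show ?thesis by auto
qed

text \<open>The ball inside \<open>A\<close> may be centered away from the origin. Testing
  \<open>z\<close> at its center and at the point at distance \<open>r\<close> from it in the
  direction of \<open>z\<close>, then subtracting, gives \<open>r * norm z \<le> 2\<close>.\<close>

lemma bounded_polar:
  fixes A :: "'a::euclidean_space set"
  assumes "interior A \<noteq> {}"
  shows "bounded (polar A)"
proof -
  obtain x0 r where r: "r > 0" "cball x0 r \<subseteq> A"
    using assms by (metis all_not_in_conv mem_interior_cball)
  have "norm z \<le> 2 / r" if z: "z \<in> polar A" for z
  proof (cases "z = 0")
    case False
    let ?y = "(r / norm z) *\<^sub>R z"
    have "x0 + ?y \<in> A" "x0 \<in> A"
      using r False by (auto simp: subset_iff dist_norm)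
    then have "\<bar>(x0 + ?y) \<bullet> z\<bar> \<le> 1" "\<bar>x0 \<bullet> z\<bar> \<le> 1"
      using z by (auto simp: polar_def)
    then have "?y \<bullet> z \<le> 2" by (simp add: inner_add_left)
    then show ?thesis
      using False r by (simp add: dot_square_norm power2_eq_square field_simps)
  qed (use r in simp)
  then show ?thesis by (auto simp: bounded_iff)
qed

lemma compact_dilate: "compact A \<Longrightarrow> compact (dilate k A)"
  for A :: "'a::real_normed_vector set"
  unfolding dilate_def by (rule compact_scaling)

lemma rectanguloid_at_dilate:
  fixes R :: "(real ^ 'n) set"
  assumes "rectanguloid_at 0 R" "0 < k"
  shows "rectanguloid_at 0 (dilate k R)"
proof -
  obtain T :: "real ^ 'n \<Rightarrow> real ^ 'n" and a where T: "orthogonal_transformation T" "\<And>i. 0 < a $ i" "R = T ` {x. \<forall>i. \<bar>x $ i\<bar> \<le> a $ i}"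
    using assms(1) unfolding rectanguloid_at_def add_0 by blast
  have "dilate k {x. \<forall>i. \<bar>x $ i\<bar> \<le> a $ i} = {x. \<forall>i. \<bar>x $ i\<bar> \<le> (k *\<^sub>R a) $ i}"
  proof (intro set_eqI iffI)
    fix x assume "x \<in> {x. \<forall>i. \<bar>x $ i\<bar> \<le> (k *\<^sub>R a) $ i}"
    then have "x /\<^sub>R k \<in> {x. \<forall>i. \<bar>x $ i\<bar> \<le> a $ i}"
      using assms(2) by (auto simp: abs_mult field_simps)
    then show "x \<in> dilate k {x. \<forall>i. \<bar>x $ i\<bar> \<le> a $ i}"
      unfolding dilate_def by (rule rev_image_eqI) (use assms(2) in simp)
  qed (use assms(2) in \<open>auto simp: dilate_def abs_mult\<close>)
  moreover have "dilate k R = T ` dilate k {x. \<forall>i. \<bar>x $ i\<bar> \<le> a $ i}"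
    using T(1) by (auto simp: T(3) dilate_def image_image orthogonal_transformation_scaleR)
  ultimately show ?thesis
    using T(1,2) assms(2) unfolding rectanguloid_at_def
    by (intro exI[of _ T] exI[of _ "k *\<^sub>R a"]) auto
qed

lemma rectanguloid_at_0_props:
  fixes R :: "(real ^ 'n) set"
  assumes "rectanguloid_at 0 R"
  shows "compact R" "0 \<in> interior R"
proof -
  obtain T :: "real ^ 'n \<Rightarrow> real ^ 'n" and a where T: "orthogonal_transformation T" "\<And>i. 0 < a $ i" "R = T ` {x. \<forall>i. \<bar>x $ i\<bar> \<le> a $ i}"
    using assms unfolding rectanguloid_at_def add_0 by blast
  have box: "{x. \<forall>i. \<bar>x $ i\<bar> \<le> a $ i} = cbox (- a) a"
    by (auto simp: mem_box_cart abs_le_iff) (metis minus_le_iff)+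
  have lin: "linear T" using T(1) by (rule orthogonal_transformation_linear)
  show "compact R"
    unfolding T(3) box using lin
    by (intro compact_continuous_image linear_continuous_on) (auto simp: linear_conv_bounded_linear)
  have "0 \<in> interior (cbox (- a) a)"
    using T(2) by (simp add: mem_box_cart)
  then have "T 0 \<in> T ` interior (cbox (- a) a)" by (rule imageI)
  then show "0 \<in> interior R"
    unfolding T(3) box interior_injective_linear_image[OF lin orthogonal_transformation_inj[OF T(1)]]
    using linear_0[OF lin] by simp
qed

text \<open>Closedness of \<open>S\<close> is read off from the same coordinates; together with the
  enclosing box it yields compactness in \<open>ellipsoid_at_0_props\<close>.\<close>

lemma ellipsoid_between_rectanguloids:
  fixes S :: "(real ^ 'n) set"
  assumes "ellipsoid_at 0 S"
  obtains R where "rectanguloid_at 0 R" "R \<subseteq> S" "S \<subseteq> dilate (sqrt (real CARD('n))) R" "closed S"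
proof -
  let ?r = "sqrt (real CARD('n))"
  obtain T :: "real ^ 'n \<Rightarrow> real ^ 'n" and a where T: "orthogonal_transformation T" "\<And>i. 0 < a $ i"
    "S = T ` {x. (\<Sum>i\<in>UNIV. (x $ i / a $ i)\<^sup>2) \<le> 1}"
    using assms unfolding ellipsoid_at_def add_0 by blast
  let ?E = "{x. (\<Sum>i\<in>UNIV. (x $ i / a $ i)\<^sup>2) \<le> 1}"
  have r: "?r > 0" by simp
  define b where "b = a /\<^sub>R ?r"
  let ?B = "{x. \<forall>i. \<bar>x $ i\<bar> \<le> b $ i}"
  have sub1: "?B \<subseteq> ?E"
  proof
    fix x assume x: "x \<in> ?B"
    have "(x $ i / a $ i)\<^sup>2 \<le> 1 / real CARD('n)" for i
    proof -
      have "\<bar>x $ i / a $ i\<bar> \<le> 1 / ?r"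
        using x T(2)[of i] r by (auto simp: b_def field_simps)
      then have "\<bar>x $ i / a $ i\<bar>\<^sup>2 \<le> (1 / ?r)\<^sup>2"
        by (intro power_mono) auto
      then show ?thesis by (simp add: power_divide)
    qed
    then have "(\<Sum>i\<in>UNIV. (x $ i / a $ i)\<^sup>2) \<le> (\<Sum>i\<in>(UNIV::'n set). 1 / real CARD('n))"
      by (intro sum_mono)
    then show "x \<in> ?E" by simp
  qed
  have le: "\<bar>x $ i\<bar> \<le> a $ i" if "x \<in> ?E" for x i
  proof -
    have "(x $ i / a $ i)\<^sup>2 \<le> (\<Sum>i\<in>UNIV. (x $ i / a $ i)\<^sup>2)"
      by (rule member_le_sum) auto
    then have "(x $ i / a $ i)\<^sup>2 \<le> 1" using that by simp
    then show ?thesis using T(2)[of i] by (simp add: abs_square_le_1)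
  qed
  have sub2: "?E \<subseteq> dilate ?r ?B"
  proof
    fix x assume "x \<in> ?E"
    then have "x /\<^sub>R ?r \<in> ?B"
      using le r by (auto simp: b_def abs_mult)
    then show "x \<in> dilate ?r ?B"
      unfolding dilate_def by (rule rev_image_eqI) (use r in simp)
  qed
  have "closed ?E"
    using T(2) by (intro closed_Collect_le continuous_intros) (auto simp: less_imp_neq[symmetric])
  moreover have "linear T" using T(1) by (rule orthogonal_transformation_linear)
  ultimately have "closed S"
    unfolding T(3) using T(1) by (intro closed_injective_linear_image orthogonal_transformation_inj)
  moreover have "rectanguloid_at 0 (T ` ?B)"
    unfolding rectanguloid_at_def using T(1,2) r
    by (intro exI[of _ T] exI[of _ b]) (auto simp: b_def)
  moreover have "T ` ?B \<subseteq> S" using sub1 T(3) by auto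
  moreover have "dilate ?r (T ` ?B) = T ` dilate ?r ?B"
    using T(1) by (auto simp: dilate_def image_image orthogonal_transformation_scaleR)
  then have "S \<subseteq> dilate ?r (T ` ?B)" using sub2 T(3) by auto
  ultimately show ?thesis using that by blast
qed

lemma ellipsoid_at_0_props:
  fixes S :: "(real ^ 'n) set"
  assumes "ellipsoid_at 0 S"
  shows "compact S" "0 \<in> interior S"
proof -
  obtain R where R: "rectanguloid_at 0 R" "R \<subseteq> S" "S \<subseteq> dilate (sqrt (real CARD('n))) R" "closed S"
    using ellipsoid_between_rectanguloids[OF assms] by metis
  show "0 \<in> interior S"
    using rectanguloid_at_0_props(2)[OF R(1)] interior_mono[OF R(2)] by auto
  have "bounded S"
    using compact_imp_bounded[OF compact_dilate[OF rectanguloid_at_0_props(1)[OF R(1)]]] R(3)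
    by (rule bounded_subset)
  then show "compact S" using R(4) by (simp add: compact_eq_bounded_closed)
qed

lemma sets_lebesgue_compact: "compact A \<Longrightarrow> A \<in> sets lebesgue"
  by (simp add: compact_imp_closed)

lemma sets_lebesgue_polar: "polar A \<in> sets lebesgue"
  for A :: "'a::euclidean_space set"
  by (simp add: closed_polar)

text \<open>The common comparison step, used with \<open>A, A', B, B'\<close> equal to
  \<open>S\<close>, \<surd>n \<open>S\<close>, \<open>R\<close>, n \<open>R\<close> for boxes
  against ellipsoids, and to \<open>E\<close>, \<open>E\<close>, \<open>S\<close>, \<surd>n
  \<open>S\<close> for ellipsoids against general sets. The interior of \<open>B\<close> keeps the
  larger polar bounded.\<close>

lemma mass_product_mono:
  fixes u w :: "'a::euclidean_space \<Rightarrow> ennreal"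
  assumes "locally_integrable_ennreal u" "locally_integrable_ennreal w" "0 \<le> s" "0 \<le> t"
    and "interior B \<noteq> {}" "polar A \<subseteq> polar B"
    and "A' \<in> sets lebesgue" "A' \<subseteq> B'" "compact B'"
  shows "mass u (polar A) powr s * mass w A' powr t \<le> mass u (polar B) powr s * mass w B' powr t"
    and "mass u A' powr s * mass w (polar A) powr t \<le> mass u B' powr s * mass w (polar B) powr t"
proof -
  have "mass f (polar A) \<le> mass f (polar B)" "mass f A' \<le> mass f B'"
    if "locally_integrable_ennreal f" for f
    using mass_mono[OF that sets_lebesgue_polar assms(6) sets_lebesgue_polar bounded_polar[OF assms(5)]]
      mass_mono[OF that assms(7,8) sets_lebesgue_compact[OF assms(9)] compact_imp_bounded[OF assms(9)]]
    by auto
  then show "mass u (polar A) powr s * mass w A' powr t \<le> mass u (polar B) powr s * mass w B' powr t"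
    and "mass u A' powr s * mass w (polar A) powr t \<le> mass u B' powr s * mass w (polar B) powr t"
    using assms by (auto intro!: powr_mult_powr_mono simp: mass_nonneg)
qed

lemma dilate_dilate: "dilate k (dilate l A) = dilate (k * l) A"
  by (simp add: dilate_def image_image)

lemma dilate_mono: "A \<subseteq> B \<Longrightarrow> dilate k A \<subseteq> dilate k B"
  by (auto simp: dilate_def)

section \<open>The implications between the three conditions\<close>

lemma rectanguloid_imp_ellipsoid_condition:
  fixes u w :: "real ^ 'n \<Rightarrow> ennreal"
  assumes pq: "1 < p" "1 < q"
    and uw: "locally_integrable_ennreal u" "locally_integrable_ennreal w"
    and "rectanguloid_condition p q u w"
  shows "ellipsoid_condition p q u w"
proof -
  let ?r = "sqrt (real CARD('n))"
  have st: "0 \<le> 1 / q" "0 \<le> 1 / conj_exp p" using pq by (auto simp: conj_exp_def)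
  obtain C where C: "\<And>R. rectanguloid_at 0 R \<Longrightarrow>
      mass u (polar R) powr (1 / q) * mass w (dilate (real CARD('n)) R) powr (1 / conj_exp p) \<le> C \<and>
      mass u (dilate (real CARD('n)) R) powr (1 / q) * mass w (polar R) powr (1 / conj_exp p) \<le> C"
    using assms(5) unfolding rectanguloid_condition_def by blast
  show ?thesis
    unfolding ellipsoid_condition_def
  proof (intro exI allI impI)
    fix S :: "(real ^ 'n) set"
    assume S: "ellipsoid_at 0 S"
    obtain R where R: "rectanguloid_at 0 R" "R \<subseteq> S" "S \<subseteq> dilate ?r R"
      using ellipsoid_between_rectanguloids[OF S] by metis
    \<comment> \<open>One factor \<surd>n comes from the ellipsoid condition and another from
      enclosing \<open>S\<close> in a dilate of \<open>R\<close>; their product is the factor n of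
      the rectanguloid condition.\<close>
    have sub: "dilate ?r S \<subseteq> dilate (real CARD('n)) R"
      using dilate_mono[OF R(3), of ?r] by (simp add: dilate_dilate)
    have int: "interior R \<noteq> {}"
      using rectanguloid_at_0_props(2)[OF R(1)] by auto
    have meas: "dilate ?r S \<in> sets lebesgue"
      by (intro sets_lebesgue_compact compact_dilate ellipsoid_at_0_props(1) S)
    have comp: "compact (dilate (real CARD('n)) R)"
      by (intro compact_dilate rectanguloid_at_0_props(1) R(1))
    show "mass u (polar S) powr (1 / q) * mass w (dilate ?r S) powr (1 / conj_exp p) \<le> C \<and>
        mass u (dilate ?r S) powr (1 / q) * mass w (polar S) powr (1 / conj_exp p) \<le> C"
      using C[OF R(1)] mass_product_mono[OF uw st int polar_antimono[OF R(2)] meas sub comp]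
      by linarith
  qed
qed

lemma ellipsoid_imp_bounded_set_condition:
  fixes u w :: "real ^ 'n \<Rightarrow> ennreal"
  assumes pq: "1 < p" "1 < q"
    and uw: "locally_integrable_ennreal u" "locally_integrable_ennreal w"
    and "ellipsoid_condition p q u w"
  shows "bounded_set_condition p q u w"
proof -
  let ?r = "sqrt (real CARD('n))"
  have st: "0 \<le> 1 / q" "0 \<le> 1 / conj_exp p" using pq by (auto simp: conj_exp_def)
  obtain C where C: "\<And>S. ellipsoid_at 0 S \<Longrightarrow>
      mass u (polar S) powr (1 / q) * mass w (dilate ?r S) powr (1 / conj_exp p) \<le> C \<and>
      mass u (dilate ?r S) powr (1 / q) * mass w (polar S) powr (1 / conj_exp p) \<le> C"
    using assms(5) unfolding ellipsoid_condition_def by blast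
  show ?thesis
    unfolding bounded_set_condition_def
  proof (intro exI allI impI)
    fix E :: "(real ^ 'n) set"
    assume E: "bounded E \<and> E \<in> sets lebesgue \<and> 0 \<in> E \<and> interior E \<noteq> {}"
    then obtain S where S: "ellipsoid_at 0 S" "E \<subseteq> dilate ?r S" "polar E \<subseteq> polar S"
      using Loewner_ellipsoid by metis
    have int: "interior S \<noteq> {}"
      using ellipsoid_at_0_props(2)[OF S(1)] by auto
    have comp: "compact (dilate ?r S)"
      by (intro compact_dilate ellipsoid_at_0_props(1) S(1))
    have "E \<in> sets lebesgue" using E by simp
    then show "mass u (polar E) powr (1 / q) * mass w E powr (1 / conj_exp p) \<le> C \<and>
        mass u E powr (1 / q) * mass w (polar E) powr (1 / conj_exp p) \<le> C"
      using C[OF S(1)] mass_product_mono[OF uw st int S(3) _ S(2) comp] by force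
  qed
qed

text \<open>The predicate \<open>P\<close> and the factor \<open>k\<close> let one argument serve
  ellipsoids with factor \<surd>n and boxes with factor n. Each such \<open>A\<close> is itself an
  admissible set \<open>E\<close>, and the dilation costs only a constant.\<close>

lemma bounded_set_condition_dilate:
  fixes u w :: "real ^ 'n \<Rightarrow> ennreal"
  assumes pq: "1 < p" "1 < q"
    and bnd: "bounded_set_condition p q u w"
    and P: "\<And>A. P A \<Longrightarrow> compact A \<and> 0 \<in> interior A"
    and u: "0 \<le> c" "\<And>A. P A \<Longrightarrow> mass u (dilate k A) \<le> c * mass u A"
    and w: "0 \<le> d" "\<And>A. P A \<Longrightarrow> mass w (dilate k A) \<le> d * mass w A"
  shows "\<exists>C. \<forall>A. P A \<longrightarrow>
    mass u (polar A) powr (1 / q) * mass w (dilate k A) powr (1 / conj_exp p) \<le> C \<and>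
    mass u (dilate k A) powr (1 / q) * mass w (polar A) powr (1 / conj_exp p) \<le> C"
proof -
  let ?s = "1 / q" and ?t = "1 / conj_exp p"
  have st: "0 \<le> ?s" "0 \<le> ?t" using pq by (auto simp: conj_exp_def)
  obtain C where C: "\<And>E. \<lbrakk>bounded E; E \<in> sets lebesgue; 0 \<in> E; interior E \<noteq> {}\<rbrakk> \<Longrightarrow>
        mass u (polar E) powr ?s * mass w E powr ?t \<le> C \<and>
        mass u E powr ?s * mass w (polar E) powr ?t \<le> C"
    using bnd unfolding bounded_set_condition_def by blast
  show ?thesis
  proof (intro exI allI impI)
    fix A assume A: "P A"
    \<comment> \<open>The second product is written with its factors swapped, so that in both the
      mass of \<open>A\<close> is the second factor, the one that \<open>powr_mult_powr_le\<close>
      enlarges.\<close>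
    have CA: "mass u (polar A) powr ?s * mass w A powr ?t \<le> C" "mass w (polar A) powr ?t * mass u A powr ?s \<le> C"
      using C[of A] P[OF A] interior_subset[of A]
      by (auto simp: mult.commute intro: compact_imp_bounded sets_lebesgue_compact)
    have "mass u (polar A) powr ?s * mass w (dilate k A) powr ?t \<le> C * d powr ?t"
      using w(1) w(2)[OF A] st by (intro powr_mult_powr_le[OF CA(1)]) (auto simp: mass_nonneg)
    moreover have "mass w (polar A) powr ?t * mass u (dilate k A) powr ?s \<le> C * c powr ?s"
      using u(1) u(2)[OF A] st by (intro powr_mult_powr_le[OF CA(2)]) (auto simp: mass_nonneg)
    ultimately show "mass u (polar A) powr ?s * mass w (dilate k A) powr ?t \<le> max (C * d powr ?t) (C * c powr ?s) \<and>
      mass u (dilate k A) powr ?s * mass w (polar A) powr ?t \<le> max (C * d powr ?t) (C * c powr ?s)"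
      by (simp add: mult.commute le_max_iff_disj)
  qed
qed

lemma dilation_comparable_upper:
  fixes f :: "real ^ 'n \<Rightarrow> ennreal"
  assumes "dilation_comparable f"
  obtains c where "0 < c"
    "\<And>A. rectanguloid_at 0 A \<or> ellipsoid_at 0 A \<Longrightarrow> mass f (dilate (sqrt (real CARD('n))) A) \<le> c * mass f A"
  using assms unfolding dilation_comparable_def by meson

lemma bounded_set_imp_ellipsoid_condition:
  fixes u w :: "real ^ 'n \<Rightarrow> ennreal"
  assumes "1 < p" "1 < q" "dilation_comparable u" "dilation_comparable w"
    and "bounded_set_condition p q u w"
  shows "ellipsoid_condition p q u w"
proof -
  let ?r = "sqrt (real CARD('n))"
  obtain c where c: "0 < c" "\<And>A. ellipsoid_at 0 A \<Longrightarrow> mass u (dilate ?r A) \<le> c * mass u A"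
    using dilation_comparable_upper[OF assms(3)] by metis
  obtain d where d: "0 < d" "\<And>A. ellipsoid_at 0 A \<Longrightarrow> mass w (dilate ?r A) \<le> d * mass w A"
    using dilation_comparable_upper[OF assms(4)] by metis
  show ?thesis
    unfolding ellipsoid_condition_def using c d ellipsoid_at_0_props
    by (intro bounded_set_condition_dilate[OF assms(1,2,5), where c = c and d = d]) auto
qed

lemma bounded_set_imp_rectanguloid_condition:
  fixes u w :: "real ^ 'n \<Rightarrow> ennreal"
  assumes "1 < p" "1 < q" "dilation_comparable u" "dilation_comparable w"
    and "bounded_set_condition p q u w"
  shows "rectanguloid_condition p q u w"
proof -
  \<comment> \<open>Dilation by n is dilation by \<surd>n applied twice, and the intermediate set is
    again a box, so the constant is squared.\<close>
  have twice: "\<exists>c\<ge>0. \<forall>A. rectanguloid_at 0 A \<longrightarrow> mass f (dilate (real CARD('n)) A) \<le> c * mass f A"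
    if f: "dilation_comparable f" for f :: "real ^ 'n \<Rightarrow> ennreal"
  proof -
    let ?r = "sqrt (real CARD('n))"
    obtain c where c: "0 < c" "\<And>A. rectanguloid_at 0 A \<Longrightarrow> mass f (dilate ?r A) \<le> c * mass f A"
      using dilation_comparable_upper[OF f] by metis
    have "mass f (dilate (real CARD('n)) A) \<le> (c * c) * mass f A" if A: "rectanguloid_at 0 A" for A
    proof -
      have "mass f (dilate ?r (dilate ?r A)) \<le> c * mass f (dilate ?r A)"
        using A by (intro c rectanguloid_at_dilate) auto
      also have "\<dots> \<le> c * (c * mass f A)"
        using c A by (intro mult_left_mono) auto
      finally show ?thesis by (simp add: dilate_dilate)
    qed
    with c(1) show ?thesis by (intro exI[of _ "c * c"]) auto
  qed
  obtain c where c: "0 \<le> c" "\<And>A. rectanguloid_at 0 A \<Longrightarrow> mass u (dilate (real CARD('n)) A) \<le> c * mass u A"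
    using twice[OF assms(3)] by blast
  obtain d where d: "0 \<le> d" "\<And>A. rectanguloid_at 0 A \<Longrightarrow> mass w (dilate (real CARD('n)) A) \<le> d * mass w A"
    using twice[OF assms(4)] by blast
  show ?thesis
    unfolding rectanguloid_condition_def using c d rectanguloid_at_0_props
    by (intro bounded_set_condition_dilate[OF assms(1,2,5), where c = c and d = d]) auto
qed

theorem theorem2:
  fixes p q :: real and u v :: "real ^ 'n \<Rightarrow> real" and w :: "real ^ 'n \<Rightarrow> ennreal"
  assumes "1 < p" and "1 < q" and "CARD('n) \<ge> 2"
    and "weight u" and "weight v"
    and "w = dual_weight p v" and "locally_integrable_ennreal w"
  shows "(rectanguloid_condition p q (\<lambda>x. ennreal (u x)) w \<longrightarrow> ellipsoid_condition p q (\<lambda>x. ennreal (u x)) w) \<and>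
         (ellipsoid_condition p q (\<lambda>x. ennreal (u x)) w \<longrightarrow> bounded_set_condition p q (\<lambda>x. ennreal (u x)) w) \<and>
         (dilation_comparable (\<lambda>x. ennreal (u x)) \<and> dilation_comparable w \<longrightarrow>
            (rectanguloid_condition p q (\<lambda>x. ennreal (u x)) w \<longleftrightarrow> ellipsoid_condition p q (\<lambda>x. ennreal (u x)) w) \<and>
            (ellipsoid_condition p q (\<lambda>x. ennreal (u x)) w \<longleftrightarrow> bounded_set_condition p q (\<lambda>x. ennreal (u x)) w))"
  using rectanguloid_imp_ellipsoid_condition[OF assms(1,2) locally_integrable_weight[OF assms(4)] assms(7)]
    ellipsoid_imp_bounded_set_condition[OF assms(1,2) locally_integrable_weight[OF assms(4)] assms(7)]
    bounded_set_imp_ellipsoid_condition[OF assms(1,2)]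
    bounded_set_imp_rectanguloid_condition[OF assms(1,2)]
  by blast

end
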